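(* Let $V$ be a simple semi-free semi-vector space over $\mathbb{R}_0^+$, let $T:V\to V$ be a semi-linear operator, and let $B=\{v_1,v_2,\ldots,v_n\}$ be a finite semi-basis of $V$. Then the matrix $[T]_B^B$ is diagonal if and only if $B$ consists of eigenvectors of $T$.
   Context: $\mathbb{R}_0^+=[0,\infty)$. A semi-vector space over $\mathbb{R}_0^+$ is a set $V$ with operations $+:V\times V\to V$ and $\cdot:\mathbb{R}_0^+\times V\to V$ such that: (1) $(V,+)$ is an abelian monoid (with identity $0_V$) satisfying the cancellation law $u+v=u+w\Rightarrow v=w$; (2) $\alpha(u+v)=\alpha u+\alpha v$; (3) $(\alpha+\beta)v=\alpha v+\beta v$; (4) $(\alpha\beta)v=\alpha(\beta v)$; (5) $1v=v$. $V$ is simple if $u+v=0_V$ implies $u=v=0_V$. A semi-basis of a simple semi-vector space $V$ is a subset $B\subset V$ (of nonzero vectors) such that every $v\in V$, $v\ne 0_V$, can be written in a unique way as a finite sum $v=\sum_{i\in I_v}v^{(i)}b_i$ with $v^{(i)}>0$ and $b_i\in B$ distinct, the finite index set $I_v$ being uniquely determined by $v$. $V$ is semi-free if it admits a semi-basis. A semi-linear operator on $V$ is a map $T:V\to V$ with $T(u+v)=T(u)+T(v)$ and $T(\lambda v)=\lambda T(v)$ for all $u,v\in V$, $\lambda\in\mathbb{R}_0^+$. A vector $v\neq 0_V$ is an eigenvector of $T$ if there is $\lambda\in\mathbb{R}_0^+$ with $T(v)=\lambda v$. For a finite semi-basis $B=\{v_1,\ldots,v_n\}$, the matrix $[T]_B^B$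 is the $n\times n$ matrix $(a_{ij})$ with entries in $\mathbb{R}_0^+$ determined by $T(v_j)=\sum_{i=1}^n a_{ij}v_i$ (basis vectors not occurring in the expansion get coefficient $0$). *)

theory Defs
  imports Complex_Main "Jordan_Normal_Form.Matrix"
begin

text \<open>
  The underlying set of the semi-vector space is the whole type, its addition and zero are those
  of the class \<^class>\<open>comm_monoid_add\<close>. A scalar in $[0,\infty)$ is a real number assumed to be
  nonnegative; nothing is required of multiplication by negative reals.
  The cancellation law is stated explicitly because the class \<^class>\<open>cancel_comm_monoid_add\<close>
  carries a subtraction operation, which is not part of the structure.
\<close>

locale semi_vector_space =
  fixes scale :: "real \<Rightarrow> 'v::comm_monoid_add \<Rightarrow> 'v"
  assumes add_cancel: "(u::'v) + v = u + w \<Longrightarrow> v = w"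
    and scale_add_right: "0 \<le> a \<Longrightarrow> scale a (u + v) = scale a u + scale a v"
    and scale_add_left: "0 \<le> a \<Longrightarrow> 0 \<le> b \<Longrightarrow> scale (a + b) v = scale a v + scale b v"
    and scale_mult: "0 \<le> a \<Longrightarrow> 0 \<le> b \<Longrightarrow> scale (a * b) v = scale a (scale b v)"
    and scale_one: "scale 1 v = v"

locale simple_semi_vector_space = semi_vector_space scale
  for scale :: "real \<Rightarrow> 'v::comm_monoid_add \<Rightarrow> 'v" +
  assumes simple: "(u::'v) + v = 0 \<Longrightarrow> u = 0 \<and> v = 0"

text \<open>
  An expansion of \<open>v\<close> over \<open>B\<close> consists of a finite index set \<open>I\<close> and positive
  coefficients \<open>c\<close> on \<open>I\<close>. Requiring \<open>c\<close> to vanish outside \<open>I\<close> only makes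
  \<open>c\<close> determined as a total function by its values on \<open>I\<close>, so that uniqueness of the
  pair \<open>(I, c)\<close> is uniqueness of the expansion.
\<close>

definition is_expansion ::
  "(real \<Rightarrow> 'v::comm_monoid_add \<Rightarrow> 'v) \<Rightarrow> 'v set \<Rightarrow> 'v \<Rightarrow> 'v set \<Rightarrow> ('v \<Rightarrow> real) \<Rightarrow> bool" where
  "is_expansion scale B v I c \<longleftrightarrow>
     finite I \<and> I \<subseteq> B \<and> (\<forall>b\<in>I. 0 < c b) \<and> (\<forall>b. b \<notin> I \<longrightarrow> c b = 0) \<and>
     v = (\<Sum>b\<in>I. scale (c b) b)"

definition semi_basis :: "(real \<Rightarrow> 'v::comm_monoid_add \<Rightarrow> 'v) \<Rightarrow> 'v set \<Rightarrow> bool" where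
  "semi_basis scale B \<longleftrightarrow>
     0 \<notin> B \<and> (\<forall>v. v \<noteq> 0 \<longrightarrow> (\<exists>!(I, c). is_expansion scale B v I c))"

definition semi_free :: "(real \<Rightarrow> 'v::comm_monoid_add \<Rightarrow> 'v) \<Rightarrow> bool" where
  "semi_free scale \<longleftrightarrow> (\<exists>B. semi_basis scale B)"

definition semi_linear ::
  "(real \<Rightarrow> 'v::comm_monoid_add \<Rightarrow> 'v) \<Rightarrow> ('v \<Rightarrow> 'v) \<Rightarrow> bool" where
  "semi_linear scale T \<longleftrightarrow>
     (\<forall>u v. T (u + v) = T u + T v) \<and> (\<forall>a v. 0 \<le> a \<longrightarrow> T (scale a v) = scale a (T v))"

definition semi_eigenvector ::
  "(real \<Rightarrow> 'v::comm_monoid_add \<Rightarrow> 'v) \<Rightarrow> ('v \<Rightarrow> 'v) \<Rightarrow> 'v \<Rightarrow> bool" where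
  "semi_eigenvector scale T v \<longleftrightarrow> v \<noteq> 0 \<and> (\<exists>a\<ge>0. T v = scale a v)"

text \<open>
  The finite semi-basis is given as a list \<open>vs\<close> of its elements, so that the matrix is
  determined including the order of its rows and columns (indexed from 0). If \<open>vs\<close> is distinct
  and its elements form a semi-basis of a simple semi-vector space, exactly one matrix satisfies
  the description, also when some \<open>T (vs ! j)\<close> is zero.
\<close>

definition semi_matrix ::
  "(real \<Rightarrow> 'v::comm_monoid_add \<Rightarrow> 'v) \<Rightarrow> 'v list \<Rightarrow> ('v \<Rightarrow> 'v) \<Rightarrow> real mat" where
  "semi_matrix scale vs T =
     (THE A. A \<in> carrier_mat (length vs) (length vs) \<and>
        (\<forall>i<length vs. \<forall>j<length vs. 0 \<le> A $$ (i, j)) \<and>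
        (\<forall>j<length vs. T (vs ! j) = (\<Sum>i<length vs. scale (A $$ (i, j)) (vs ! i))))"

end

theory Submission
  imports Defs
begin

text \<open>
  A finite semi-basis gives every vector, including zero, exactly one family of nonnegative
  coordinates; for zero this is where simplicity enters. Hence the matrix of \<open>T\<close> is well defined,
  and its \<open>j\<close>-th column is supported on the diagonal exactly when \<open>T\<close> scales the \<open>j\<close>-th basis vector.
\<close>

context semi_vector_space
begin

lemma scale_zero_left: "scale 0 v = 0"
  using scale_add_left[of 0 0 v] add_cancel[of "scale 0 v" "scale 0 v" 0] by simp

lemma scale_zero_right: "0 \<le> a \<Longrightarrow> scale a 0 = 0"
  using scale_add_right[of a 0 0] add_cancel[of "scale a 0" "scale a 0" 0] by simp

text \<open>The inverse of a positive scalar is again a nonnegative scalar, so scaling by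
  \<open>a\<close> can be undone.\<close>

lemma scale_eq_zero:
  assumes "0 < a" "scale a v = 0"
  shows "v = 0"
proof -
  have "v = scale (inverse a) (scale a v)"
    using assms(1) scale_mult[of "inverse a" a v] by (simp add: scale_one)
  then show ?thesis
    using assms by (simp add: scale_zero_right)
qed

text \<open>Discarding the terms with coefficient 0 leaves the sum unchanged. This lets the
  uniqueness clause of a semi-basis be applied to nonnegative families on all of
  \<open>B\<close>.\<close>

lemma is_expansion_support:
  assumes "finite B" "\<And>b. b \<in> B \<Longrightarrow> 0 \<le> c b" "v = (\<Sum>b\<in>B. scale (c b) b)"
  shows "is_expansion scale B v {b\<in>B. 0 < c b} (\<lambda>b. if b \<in> B then c b else 0)"
proof -
  have "(\<Sum>b\<in>B. scale (c b) b) = (\<Sum>b\<in>{b\<in>B. 0 < c b}. scale (c b) b)"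
    by (rule sum.mono_neutral_right)
      (use assms in \<open>auto simp: scale_zero_left less_le\<close>)
  also have "\<dots> = (\<Sum>b\<in>{b\<in>B. 0 < c b}. scale (if b \<in> B then c b else 0) b)"
    by (rule sum.cong) auto
  finally show ?thesis
    using assms by (force simp: is_expansion_def)
qed

lemma is_expansion_sum:
  assumes "finite B" "is_expansion scale B v I c"
  shows "v = (\<Sum>b\<in>B. scale (c b) b)"
proof -
  have "(\<Sum>b\<in>B. scale (c b) b) = (\<Sum>b\<in>I. scale (c b) b)"
    by (rule sum.mono_neutral_right)
      (use assms in \<open>auto simp: is_expansion_def scale_zero_left\<close>)
  then show ?thesis
    using assms(2) by (simp add: is_expansion_def)
qed

text \<open>The semi-basis condition speaks only of nonzero vectors, so zero is given the zero
  family; any other expansion is padded with zeros to all of \<open>B\<close>.\<close>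

lemma semi_basis_coordinates:
  assumes "finite B" "semi_basis scale B"
  obtains c where "\<And>b. 0 \<le> c b" "v = (\<Sum>b\<in>B. scale (c b) b)"
proof (cases "v = 0")
  case True
  show ?thesis
    using that[of "\<lambda>_. 0"] True by (simp add: scale_zero_left)
next
  case False
  then obtain I c where e: "is_expansion scale B v I c"
    using assms(2) unfolding semi_basis_def by blast
  then have "0 \<le> c b" for b
    by (cases "b \<in> I") (auto simp: is_expansion_def less_imp_le)
  then show ?thesis
    using that is_expansion_sum[OF assms(1) e] by blast
qed

end

context simple_semi_vector_space
begin

text \<open>Splitting off one summand writes zero as a sum of two vectors, to which simplicity
  applies.\<close>

lemma sum_eq_zero:
  assumes "finite A" "sum f A = (0::'v)" "x \<in> A"
  shows "f x = 0"
  using simple[of "f x" "sum f (A - {x})"] assms by (simp add: sum.remove)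

lemma semi_basis_coordinates_unique:
  assumes B: "finite B" "semi_basis scale B"
    and c: "\<And>b. b \<in> B \<Longrightarrow> 0 \<le> c b"
    and d: "\<And>b. b \<in> B \<Longrightarrow> 0 \<le> d b"
    and eq: "(\<Sum>b\<in>B. scale (c b) b) = (\<Sum>b\<in>B. scale (d b) b)"
    and b: "b \<in> B"
  shows "c b = d b"
proof (cases "(\<Sum>b\<in>B. scale (c b) b) = 0")
  case True
  \<comment> \<open>Stated for a generic \<open>e\<close> because it is used for both
    \<open>c\<close> and \<open>d\<close>: every term of a vanishing sum vanishes, and a positive
    multiple of a basis vector does not.\<close>
  have zero: "e b = 0" if e: "\<And>b. b \<in> B \<Longrightarrow> 0 \<le> e b" "(\<Sum>b\<in>B. scale (e b) b) = 0" for e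
  proof (rule ccontr)
    assume "e b \<noteq> 0"
    then have "0 < e b"
      using e(1)[OF b] by simp
    moreover have "scale (e b) b = 0"
      using sum_eq_zero[OF B(1) e(2) b] .
    ultimately show False
      using scale_eq_zero b B(2) by (auto simp: semi_basis_def)
  qed
  then show ?thesis
    using zero[of c, OF c True] zero[of d, OF d] eq True by simp
next
  case False
  let ?v = "\<Sum>b\<in>B. scale (c b) b"
  have "\<exists>!(I, c). is_expansion scale B ?v I c"
    using B(2) False by (simp add: semi_basis_def)
  moreover have "is_expansion scale B ?v {b\<in>B. 0 < c b} (\<lambda>b. if b \<in> B then c b else 0)"
    by (rule is_expansion_support) (use B c in auto)
  moreover have "is_expansion scale B ?v {b\<in>B. 0 < d b} (\<lambda>b. if b \<in> B then d b else 0)"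
    by (rule is_expansion_support) (use B d eq in auto)
  \<comment> \<open>Both families are cut off outside \<open>B\<close>, where nothing is known about
    them, so that uniqueness of the pair yields equality of total functions.\<close>
  ultimately have "(\<lambda>b. if b \<in> B then c b else 0) = (\<lambda>b. if b \<in> B then d b else 0)"
    by blast
  from fun_cong[OF this, of b] show ?thesis
    using b by simp
qed

lemma semi_basis_list_coordinates_unique:
  assumes vs: "distinct vs" "semi_basis scale (set vs)"
    and f: "\<And>i. i < length vs \<Longrightarrow> 0 \<le> f i"
    and g: "\<And>i. i < length vs \<Longrightarrow> 0 \<le> g i"
    and eq: "(\<Sum>i<length vs. scale (f i) (vs ! i)) = (\<Sum>i<length vs. scale (g i) (vs ! i))"
    and i: "i < length vs"
  shows "f i = g i"
proof -
  \<comment> \<open>The position of a basis vector in the list, well defined by distinctness; it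
    turns families indexed by positions into families indexed by vectors.\<close>
  let ?idx = "the_inv_into {..<length vs} ((!) vs)"
  have bij: "bij_betw ((!) vs) {..<length vs} (set vs)"
    using vs(1) by (simp add: bij_betw_nth)
  have idx: "?idx (vs ! k) = k" if "k < length vs" for k
    using that by (intro the_inv_into_f_f bij_betw_imp_inj_on[OF bij]) auto
  have sum: "(\<Sum>b\<in>set vs. scale (h (?idx b)) b) = (\<Sum>k<length vs. scale (h k) (vs ! k))" for h
    unfolding sum.reindex_bij_betw[OF bij, symmetric] by (rule sum.cong) (simp_all add: idx)
  have "f (?idx (vs ! i)) = g (?idx (vs ! i))"
    by (rule semi_basis_coordinates_unique[OF _ vs(2)])
      (use f g eq i idx in \<open>auto simp: sum in_set_conv_nth\<close>)
  then show ?thesis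
    using i by (simp add: idx)
qed

text \<open>The description operator can be unfolded only once existence and uniqueness are known;
  both come from the coordinates of the vectors \<open>T (vs ! j)\<close>.\<close>

lemma semi_matrix:
  assumes vs: "distinct vs" "semi_basis scale (set vs)"
  shows semi_matrix_carrier: "semi_matrix scale vs T \<in> carrier_mat (length vs) (length vs)"
    and semi_matrix_nonneg: "\<And>i j. i < length vs \<Longrightarrow> j < length vs \<Longrightarrow> 0 \<le> semi_matrix scale vs T $$ (i, j)"
    and semi_matrix_column: "\<And>j. j < length vs \<Longrightarrow>
      T (vs ! j) = (\<Sum>i<length vs. scale (semi_matrix scale vs T $$ (i, j)) (vs ! i))"
proof -
  let ?n = "length vs"
  let ?P = "\<lambda>A. A \<in> carrier_mat ?n ?n \<and>
        (\<forall>i<?n. \<forall>j<?n. 0 \<le> A $$ (i, j)) \<and>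
        (\<forall>j<?n. T (vs ! j) = (\<Sum>i<?n. scale (A $$ (i, j)) (vs ! i)))"
  have bij: "bij_betw ((!) vs) {..<?n} (set vs)"
    using vs(1) by (simp add: bij_betw_nth)
  have "\<exists>c. (\<forall>b. 0 \<le> c b) \<and> v = (\<Sum>b\<in>set vs. scale (c b) b)" for v
    using semi_basis_coordinates[OF _ vs(2), of v] by (metis finite_set)
  then obtain c where c: "\<And>v b. 0 \<le> c v b" "\<And>v. v = (\<Sum>b\<in>set vs. scale (c v b) b)"
    by metis
  \<comment> \<open>Entry \<open>(i, j)\<close> is the coordinate of \<open>T (vs ! j)\<close> at
    \<open>vs ! i\<close>.\<close>
  have "?P (mat ?n ?n (\<lambda>(i, j). c (T (vs ! j)) (vs ! i)))"
    using c(1) c(2)[of "T _", unfolded sum.reindex_bij_betw[OF bij, symmetric]] by simp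
  \<comment> \<open>For fixed \<open>j\<close>, the \<open>j\<close>-th columns of both matrices are
    coordinates of the same vector.\<close>
  moreover have "A = A'" if "?P A" "?P A'" for A A'
  proof (rule eq_matI)
    fix i j assume "i < dim_row A'" "j < dim_col A'"
    then have "i < ?n" "j < ?n"
      using that by auto
    then show "A $$ (i, j) = A' $$ (i, j)"
      using that by (intro semi_basis_list_coordinates_unique[OF vs]) auto
  qed (use that in auto)
  ultimately have "?P (semi_matrix scale vs T)"
    unfolding semi_matrix_def by (intro theI[of ?P]) blast+
  then show "semi_matrix scale vs T \<in> carrier_mat ?n ?n"
    and "\<And>i j. i < ?n \<Longrightarrow> j < ?n \<Longrightarrow> 0 \<le> semi_matrix scale vs T $$ (i, j)"
    and "\<And>j. j < ?n \<Longrightarrow> T (vs ! j) = (\<Sum>i<?n. scale (semi_matrix scale vs T $$ (i, j)) (vs ! i))"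
    by blast+
qed

lemma sum_scale_single:
  fixes n :: nat
  assumes "j < n" "\<And>i. i < n \<Longrightarrow> i \<noteq> j \<Longrightarrow> f i = 0"
  shows "(\<Sum>i<n. scale (f i) (w i)) = scale (f j) (w j)"
proof -
  have "(\<Sum>i<n. scale (f i) (w i)) = (\<Sum>i\<in>{j}. scale (f i) (w i))"
    by (rule sum.mono_neutral_right) (use assms in \<open>auto simp: scale_zero_left\<close>)
  then show ?thesis
    by simp
qed

lemma diagonal_semi_matrix_iff:
  assumes vs: "distinct vs" "semi_basis scale (set vs)"
  shows "diagonal_mat (semi_matrix scale vs T) \<longleftrightarrow> (\<forall>v\<in>set vs. semi_eigenvector scale T v)"
    (is "diagonal_mat ?A \<longleftrightarrow> _")
proof
  assume diag: "diagonal_mat ?A"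
  show "\<forall>v\<in>set vs. semi_eigenvector scale T v"
  proof
    fix v assume v: "v \<in> set vs"
    then obtain j where j: "j < length vs" "v = vs ! j"
      by (auto simp: in_set_conv_nth)
    have "?A $$ (i, j) = 0" if "i < length vs" "i \<noteq> j" for i
      using diag that j semi_matrix_carrier[OF vs, of T] by (auto simp: diagonal_mat_def)
    then have "T v = scale (?A $$ (j, j)) v"
      using semi_matrix_column[OF vs j(1), of T] j
        sum_scale_single[OF j(1), of "\<lambda>i. ?A $$ (i, j)" "(!) vs"] by simp
    \<comment> \<open>The eigenvalue is the diagonal entry; \<open>v\<close> is nonzero because a
      semi-basis omits zero.\<close>
    then show "semi_eigenvector scale T v"
      using v vs(2) semi_matrix_nonneg[OF vs j(1) j(1), of T]
      by (auto simp: semi_eigenvector_def semi_basis_def)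
  qed
next
  assume eig: "\<forall>v\<in>set vs. semi_eigenvector scale T v"
  have "?A $$ (i, j) = 0" if ij: "i < length vs" "j < length vs" "i \<noteq> j" for i j
  proof -
    obtain a where a: "0 \<le> a" "T (vs ! j) = scale a (vs ! j)"
      using eig nth_mem[OF ij(2)] unfolding semi_eigenvector_def by blast
    \<comment> \<open>The eigenvector equation gives a second coordinate family for
      \<open>T (vs ! j)\<close>, namely \<open>a\<close> at \<open>j\<close> and 0 elsewhere;
      uniqueness identifies it with the column.\<close>
    then have "(\<Sum>i<length vs. scale (?A $$ (i, j)) (vs ! i)) =
        (\<Sum>i<length vs. scale (if i = j then a else 0) (vs ! i))"
      using semi_matrix_column[OF vs ij(2), of T]
        sum_scale_single[OF ij(2), of "\<lambda>i. if i = j then a else 0" "(!) vs"] by simp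
    then have "?A $$ (i, j) = (if i = j then a else 0)"
      by (intro semi_basis_list_coordinates_unique[OF vs, where f = "\<lambda>i. ?A $$ (i, j)"])
        (use a ij semi_matrix_nonneg[OF vs] in auto)
    then show ?thesis
      using ij(3) by simp
  qed
  then show "diagonal_mat ?A"
    using semi_matrix_carrier[OF vs, of T] by (auto simp: diagonal_mat_def)
qed

end

theorem theorem3p1:
  fixes scale :: "real \<Rightarrow> 'v::comm_monoid_add \<Rightarrow> 'v"
    and T :: "'v \<Rightarrow> 'v"
    and vs :: "'v list"
  assumes "simple_semi_vector_space scale"
    and "semi_free scale"
    and "semi_linear scale T"
    and "distinct vs"
    and "semi_basis scale (set vs)"
  shows "diagonal_mat (semi_matrix scale vs T) \<longleftrightarrow> (\<forall>v\<in>set vs. semi_eigenvector scale T v)"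
  by (rule simple_semi_vector_space.diagonal_semi_matrix_iff[OF assms(1,4,5)])

end
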